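(* Let $\alpha,\omega:A\to A$ be $\alpha(n)=(-1)\,n\,(1)$ and $\omega(n)=(1)\,n\,(-1)$. Then $\omega(D_{0})\subseteq(1,-1)D_{1}(1,-1)$, so $\omega:D_{0}\rightarrow D_{1}$ is a $*$-semigroup homomorphism with $\alpha\circ\omega$ the identity on $D_{0}$ (that is, $\omega$ splits the $*$-map $\alpha$).
   Context: A $*$-semigroup is a semigroup with an involutive map $*$ satisfying $(ab)^*=b^*a^*$; $*$-semigroup homomorphisms preserve product and $*$. The $*$-semigroup $A$: let $A_c$ be the set of finite nonempty sequences $(n_0,\dots,n_k)$ of nonzero integers with alternating signs; multiplication is concatenation, where the last entry of the left factor and the first entry of the right factor are added into a single entry if they have the same sign; $(n_0,\dots,n_k)^*=(-n_k,\dots,-n_0)$. $A$ is the quotient of $A_c$ by the congruence generated by $(n_0,\dots,n_k)\sim(n_0,\dots,n_{i-1},n_i+n_{i+1}+n_{i+2},n_{i+3},\dots,n_k)$ whenever $0\le i\le k-2$ and $n_{i+1}=\pm1$. Each element of $A$ has a unique reduced representative $(n_0,\dots,n_k)$, one with $n_j\ne\pm1$ for $1\le j\le k-1$. Let $\tau:A\to\mathbb{Z}$, $\tau(n_0,\dots,n_k)=\sum n_i$ (a homomorphism), $A^0=\tau^{-1}(0)$, and let $A_+$ be the set of reduced words with $k\ge1$, $n_0<0$, $n_k>0$. An element $p$ of a semigroup $S$ is irreducible in $S$ if it is not a product of two elements of $S$, or whenever $p=mn$ with $m,n\in S$ then $p=m$ or $p=n$; $\operatorname{Irr}(S)$ is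 the set of these, and $\operatorname{Irr}_+(A^0)=\operatorname{Irr}(A^0)\cap A_+$. $D_0$ is the subsemigroup of $A$ generated by $\operatorname{Irr}_+(A^0)$ (a $*$-semigroup with unit $(-1,1)$) and $D_1$ is the $*$-subsemigroup of $A$ generated by $(1,-1)$ and $\operatorname{Irr}_+(A^0)$. *)

theory Defs
  imports Main
begin

class star_semigroup = semigroup_mult +
  fixes star :: "'a \<Rightarrow> 'a"
  assumes star_star [simp]: "star (star a) = a"
    and star_mult: "star (a * b) = star b * star a"

definition star_subsemigroup :: "'a::star_semigroup set \<Rightarrow> bool" where
  "star_subsemigroup S \<longleftrightarrow> (\<forall>a\<in>S. \<forall>b\<in>S. a * b \<in> S) \<and> (\<forall>a\<in>S. star a \<in> S)"

definition star_semigroup_hom_on ::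
  "'a::star_semigroup set \<Rightarrow> 'b::star_semigroup set \<Rightarrow> ('a \<Rightarrow> 'b) \<Rightarrow> bool" where
  "star_semigroup_hom_on S T f \<longleftrightarrow>
     star_subsemigroup S \<and> star_subsemigroup T \<and> f ` S \<subseteq> T \<and>
     (\<forall>a\<in>S. \<forall>b\<in>S. f (a * b) = f a * f b) \<and>
     (\<forall>a\<in>S. f (star a) = star (f a))"

inductive_set gen_subsemigroup :: "'a::semigroup_mult set \<Rightarrow> 'a set" for X where
  gen: "a \<in> X \<Longrightarrow> a \<in> gen_subsemigroup X"
| mult: "a \<in> gen_subsemigroup X \<Longrightarrow> b \<in> gen_subsemigroup X \<Longrightarrow> a * b \<in> gen_subsemigroup X"

inductive_set gen_star_subsemigroup :: "'a::star_semigroup set \<Rightarrow> 'a set" for X where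
  gen: "a \<in> X \<Longrightarrow> a \<in> gen_star_subsemigroup X"
| mult: "a \<in> gen_star_subsemigroup X \<Longrightarrow> b \<in> gen_star_subsemigroup X \<Longrightarrow>
    a * b \<in> gen_star_subsemigroup X"
| star: "a \<in> gen_star_subsemigroup X \<Longrightarrow> star a \<in> gen_star_subsemigroup X"

definition Irr :: "'a::semigroup_mult set \<Rightarrow> 'a set" where
  "Irr S = {p \<in> S. (\<not> (\<exists>m\<in>S. \<exists>n\<in>S. p = m * n)) \<or>
                   (\<forall>m\<in>S. \<forall>n\<in>S. p = m * n \<longrightarrow> p = m \<or> p = n)}"


section \<open>The semigroup \<open>A\<^sub>c\<close> of alternating words\<close>

definition alternating :: "int list \<Rightarrow> bool" where
  "alternating ns \<longleftrightarrow> ns \<noteq> [] \<and> 0 \<notin> set ns \<and> successively (\<lambda>m n. sgn m \<noteq> sgn n) ns"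

definition cat :: "int list \<Rightarrow> int list \<Rightarrow> int list" where
  "cat ms ns = (if sgn (last ms) = sgn (hd ns)
                then butlast ms @ [last ms + hd ns] @ tl ns else ms @ ns)"

definition word_star :: "int list \<Rightarrow> int list" where
  "word_star ns = rev (map uminus ns)"

lemma sgn_add_same: "sgn x = sgn y \<Longrightarrow> sgn (x + y) = sgn x" for x y :: int
  by (auto simp: sgn_if split: if_splits)

lemma cat_snoc_Cons:
  "cat (xs @ [x]) (y # ys) = (if sgn x = sgn y then xs @ (x + y) # ys else xs @ x # y # ys)"
  by (simp add: cat_def)

lemma cat_snoc_Cons2:
  "cat (w # xs @ [x]) (y # ys) =
    (if sgn x = sgn y then w # xs @ (x + y) # ys else w # xs @ x # y # ys)"
  using cat_snoc_Cons[of "w # xs" x y ys] by simp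

lemma cat_single_Cons:
  "cat [x] (y # ys) = (if sgn x = sgn y then (x + y) # ys else x # y # ys)"
  using cat_snoc_Cons[of "[]" x y ys] by simp

lemma alternating_cat:
  assumes "alternating ms" "alternating ns"
  shows "alternating (cat ms ns)"
proof -
  obtain xs x where ms: "ms = xs @ [x]"
    using assms(1) by (metis alternating_def rev_exhaust)
  obtain y ys where ns: "ns = y # ys"
    using assms(2) by (metis alternating_def neq_Nil_conv)
  have nz: "x \<noteq> 0" "y \<noteq> 0"
    using assms by (auto simp: alternating_def ms ns)
  show ?thesis
  proof (cases "sgn x = sgn y")
    case True
    then have "sgn (x + y) = sgn x" by (rule sgn_add_same)
    moreover from this have "x + y \<noteq> 0"
      using nz by (metis sgn_0_0)
    ultimately show ?thesis
      using assms True
      by (auto simp: alternating_def ms ns cat_snoc_Cons successively_append_iff successively_Cons)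
  next
    case False
    then show ?thesis
      using assms
      by (auto simp: alternating_def ms ns cat_snoc_Cons successively_append_iff successively_Cons)
  qed
qed

lemma cat_assoc:
  assumes "ls \<noteq> []" "ms \<noteq> []" "ns \<noteq> []"
  shows "cat (cat ls ms) ns = cat ls (cat ms ns)"
proof -
  obtain xs x where ls: "ls = xs @ [x]"
    using assms(1) by (metis rev_exhaust)
  obtain z zs where ns: "ns = z # zs"
    using assms(3) by (metis neq_Nil_conv)
  obtain y ys where ms: "ms = y # ys"
    using assms(2) by (metis neq_Nil_conv)
  show ?thesis
  proof (cases ys rule: rev_exhaust)
    case Nil
    have "cat (xs @ [x, y]) (z # zs) =
        (if sgn y = sgn z then xs @ x # (y + z) # zs else xs @ x # y # z # zs)"
      using cat_snoc_Cons[of "xs @ [x]" y z zs] by simp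
    then show ?thesis
      using sgn_add_same[of x y] sgn_add_same[of y z]
      by (simp add: ls ms ns Nil cat_snoc_Cons cat_single_Cons add.assoc)
  next
    case (snoc vs v)
    have "cat (xs @ (x + y) # vs @ [v]) (z # zs) =
        (if sgn v = sgn z then xs @ (x + y) # vs @ (v + z) # zs
         else xs @ (x + y) # vs @ v # z # zs)"
      using cat_snoc_Cons[of "xs @ (x + y) # vs" v z zs] by simp
    moreover have "cat (xs @ x # y # vs @ [v]) (z # zs) =
        (if sgn v = sgn z then xs @ x # y # vs @ (v + z) # zs
         else xs @ x # y # vs @ v # z # zs)"
      using cat_snoc_Cons[of "xs @ x # y # vs" v z zs] by simp
    ultimately show ?thesis
      by (simp add: ls ms ns snoc cat_snoc_Cons cat_snoc_Cons2)
  qed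
qed

lemma alternating_word_star: "alternating ns \<Longrightarrow> alternating (word_star ns)"
  by (auto simp: alternating_def word_star_def successively_map sgn_minus
      elim!: successively_mono)

lemma word_star_word_star: "word_star (word_star ns) = ns"
  by (simp add: word_star_def rev_map o_def)

lemma word_star_cat:
  assumes "ms \<noteq> []" "ns \<noteq> []"
  shows "word_star (cat ms ns) = cat (word_star ns) (word_star ms)"
proof -
  obtain xs x where ms: "ms = xs @ [x]"
    using assms(1) by (metis rev_exhaust)
  obtain y ys where ns: "ns = y # ys"
    using assms(2) by (metis neq_Nil_conv)
  show ?thesis
    by (auto simp: ms ns cat_snoc_Cons word_star_def sgn_minus)
qed

lemma sum_list_cat:
  assumes "ms \<noteq> []" "ns \<noteq> []"
  shows "sum_list (cat ms ns) = sum_list ms + sum_list ns"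
proof -
  obtain xs x where ms: "ms = xs @ [x]"
    using assms(1) by (metis rev_exhaust)
  obtain y ys where ns: "ns = y # ys"
    using assms(2) by (metis neq_Nil_conv)
  show ?thesis
    by (auto simp: ms ns cat_snoc_Cons)
qed

typedef altword = "{ns. alternating ns}"
  morphisms entries Altword
  by (intro exI[of _ "[1]"]) (simp add: alternating_def)

setup_lifting type_definition_altword

lemma alternating_entries: "alternating (entries w)"
  using entries by simp

lemma entries_nonempty [simp]: "entries w \<noteq> []"
  using alternating_entries by (simp add: alternating_def)

instantiation altword :: star_semigroup
begin

lift_definition times_altword :: "altword \<Rightarrow> altword \<Rightarrow> altword" is cat
  by (rule alternating_cat)

lift_definition star_altword :: "altword \<Rightarrow> altword" is word_star
  by (rule alternating_word_star)

instance
proof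
  fix a b c :: altword
  show "a * b * c = a * (b * c)"
    by transfer (simp add: cat_assoc alternating_def)
  show "star (star a) = a"
    by transfer (rule word_star_word_star)
  show "star (a * b) = star b * star a"
    by transfer (simp add: word_star_cat alternating_def)
qed

end


section \<open>The quotient \<open>A\<close>\<close>

text \<open>The congruence generated by the contractions. The replacement of \<open>a, b, c\<close> by the single
  entry \<open>a + b + c\<close> always yields an alternating word again, so asking that \<open>v\<close> be one is
  no restriction (lemma \<open>alternating_contract\<close>).\<close>

inductive word_cong :: "altword \<Rightarrow> altword \<Rightarrow> bool" where
  contract: "entries u = xs @ [a, b, c] @ ys \<Longrightarrow> b = 1 \<or> b = -1 \<Longrightarrow>
    entries v = xs @ [a + b + c] @ ys \<Longrightarrow> word_cong u v"
| refl: "word_cong u u"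
| sym: "word_cong u v \<Longrightarrow> word_cong v u"
| trans: "word_cong u v \<Longrightarrow> word_cong v w \<Longrightarrow> word_cong u w"
| mult: "word_cong u u' \<Longrightarrow> word_cong v v' \<Longrightarrow> word_cong (u * v) (u' * v')"

lemma alternating_contract:
  assumes "alternating (xs @ [a, b, c] @ ys)" "b = 1 \<or> b = -1"
  shows "alternating (xs @ [a + b + c] @ ys)"
proof -
  have "a \<noteq> 0" "c \<noteq> 0" "sgn a \<noteq> sgn b" "sgn b \<noteq> sgn c"
    using assms(1) by (auto simp: alternating_def successively_append_iff)
  then have "sgn (a + b + c) = sgn a" "sgn c = sgn a" "a + b + c \<noteq> 0"
    using assms(2) by (auto simp: sgn_if split: if_splits)
  then show ?thesis
    using assms(1)
    by (auto simp: alternating_def successively_append_iff successively_Cons)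
qed

lemma entries_mult: "entries (u * v) = cat (entries u) (entries v)"
  by (rule times_altword.rep_eq)

lemma entries_star: "entries (star u) = word_star (entries u)"
  by (rule star_altword.rep_eq)

lemma word_cong_star: "word_cong u v \<Longrightarrow> word_cong (star u) (star v)"
proof (induction rule: word_cong.induct)
  case (contract u xs a b c ys v)
  show ?case
  proof (rule word_cong.contract)
    show "entries (star u) = word_star ys @ [- c, - b, - a] @ word_star xs"
      by (simp add: entries_star contract word_star_def)
    show "entries (star v) = word_star ys @ [- c + - b + - a] @ word_star xs"
      by (simp add: entries_star contract word_star_def)
  qed (use contract in auto)
qed (auto simp: star_mult intro: word_cong.intros)

lemma word_cong_sum_list: "word_cong u v \<Longrightarrow> sum_list (entries u) = sum_list (entries v)"
  by (induction rule: word_cong.induct) (simp_all add: entries_mult sum_list_cat)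

quotient_type A = altword / word_cong
  by (intro equivpI reflpI sympI transpI) (blast intro: word_cong.intros)+

instantiation A :: star_semigroup
begin

lift_definition times_A :: "A \<Rightarrow> A \<Rightarrow> A" is "(*)"
  by (rule word_cong.mult)

lift_definition star_A :: "A \<Rightarrow> A" is star
  by (rule word_cong_star)

instance
  by standard (transfer, simp add: mult.assoc star_mult word_cong.refl)+

end

lift_definition tau :: "A \<Rightarrow> int" is "\<lambda>w. sum_list (entries w)"
  by (rule word_cong_sum_list)

text \<open>\<open>elt ns\<close> is the class of \<open>ns\<close>; it is only meaningful for alternating \<open>ns\<close>.\<close>

definition elt :: "int list \<Rightarrow> A" where
  "elt ns = abs_A (Altword ns)"

definition reduced :: "int list \<Rightarrow> bool" where
  "reduced ns \<longleftrightarrow> alternating ns \<and>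
     (\<forall>j. 1 \<le> j \<and> j + 1 < length ns \<longrightarrow> ns ! j \<noteq> 1 \<and> ns ! j \<noteq> -1)"

definition A0 :: "A set" where
  "A0 = {a. tau a = 0}"

definition A_plus :: "A set" where
  "A_plus = {elt ns | ns. reduced ns \<and> length ns \<ge> 2 \<and> hd ns < 0 \<and> last ns > 0}"

definition Irr_plus_A0 :: "A set" where
  "Irr_plus_A0 = Irr A0 \<inter> A_plus"

definition D0 :: "A set" where
  "D0 = gen_subsemigroup Irr_plus_A0"

definition D1 :: "A set" where
  "D1 = gen_star_subsemigroup (insert (elt [1, -1]) Irr_plus_A0)"

definition alpha :: "A \<Rightarrow> A" where
  "alpha n = elt [-1] * n * elt [1]"

definition omega :: "A \<Rightarrow> A" where
  "omega n = elt [1] * n * elt [-1]"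

end

theory Submission
  imports Defs
begin

text \<open>
  Write \<open>u = (1)\<close> and \<open>v = (-1)\<close>. The semigroup \<open>A\<close> is generated by \<open>u\<close> and \<open>v\<close> subject to
  \<open>uvu = u\<close> and \<open>vuv = v\<close>, with \<open>u\<^sup>* = v\<close>. Elements of \<open>D\<^sub>0\<close> begin with \<open>v\<close> and end with \<open>u\<close>, so
  \<open>vu\<close> acts on them as a unit. From \<open>\<alpha>(\<omega>(d)) = vu d vu\<close> and
  \<open>\<omega>(a) \<omega>(b) = u a (vu) b v\<close> the algebraic claims follow at once, and
  \<open>\<omega>(d) = u d v = uv (u d v) uv\<close> holds for every \<open>d\<close>. What remains is \<open>\<omega>(D\<^sub>0) \<subseteq> D\<^sub>1\<close>, and by
  multiplicativity only \<open>\<omega>(p) \<in> D\<^sub>1\<close> for \<open>p\<close> in \<open>Irr\<^sub>+(A\<^sup>0)\<close>.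

  Read a word in \<open>u\<close> and \<open>v\<close> as a lattice path that starts at height 0, where \<open>u\<close> steps up and
  \<open>v\<close> steps down. The path of a shortest word for \<open>p\<close> cannot return to height 0 before its end:
  cutting it there would factor \<open>p\<close> inside \<open>A\<^sup>0\<close>, hence one of the two factors would equal \<open>p\<close>
  and be spelled by a shorter word. So either \<open>p = vu\<close>, or \<open>p = v q u\<close> where the path of \<open>q\<close>
  ends at height 0 and never rises above it (\<open>Irr_plus_cases\<close>). In the second case
  \<open>\<omega>(p) = uv q uv\<close>, so it suffices that \<open>q\<close> lies in \<open>D\<^sub>0\<close>.

  That is \<open>peak_zero_in_D0\<close>. The maximal height of a path is an invariant of its class in \<open>A\<close>,
  and it stays at zero for both factors whenever \<open>q\<close> is written as a product in \<open>A\<^sup>0\<close>. A factor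
  with maximal height and total both zero begins with \<open>v\<close> and ends with \<open>u\<close>, so it lies in
  \<open>A\<^sub>+\<close>; factoring until every factor is irreducible therefore exhibits \<open>q\<close> in \<open>D\<^sub>0\<close>. The process
  stops because of a further invariant, the number of adjacent equal letters: it is additive on
  such products, and among the elements of \<open>A\<^sub>+\<close> it vanishes only on \<open>vu\<close>, which does not occur
  as a factor in a proper factorisation since it acts as a unit.
\<close>

section \<open>Generators and relations\<close>

lemma elt_mult:
  assumes "alternating ms" "alternating ns"
  shows "elt ms * elt ns = elt (cat ms ns)"
proof -
  have "Altword ms * Altword ns = Altword (cat ms ns)"
    using assms by (metis Altword_inverse entries_inverse entries_mult mem_Collect_eq)
  then show ?thesis
    by (simp add: elt_def times_A.abs_eq)
qed

lemma elt_entries: "elt (entries w) = abs_A w"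
  by (simp add: elt_def entries_inverse)

lemma ex_elt: "\<exists>ns. alternating ns \<and> a = elt ns"
proof (induction a rule: A.abs_induct)
  case (1 w)
  then show ?case
    using alternating_entries[of w] elt_entries[of w] by metis
qed

abbreviation up :: A where "up \<equiv> elt [1]"
abbreviation down :: A where "down \<equiv> elt [-1]"

lemma alternating_single: "alternating [n] \<longleftrightarrow> n \<noteq> 0"
  by (auto simp: alternating_def)

lemma elt_contract:
  assumes "alternating (xs @ [a, b, c] @ ys)" "b = 1 \<or> b = -1"
  shows "elt (xs @ [a, b, c] @ ys) = elt (xs @ [a + b + c] @ ys)"
proof -
  have "alternating (xs @ [a + b + c] @ ys)"
    using assms by (rule alternating_contract)
  then have "word_cong (Altword (xs @ [a, b, c] @ ys)) (Altword (xs @ [a + b + c] @ ys))"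
    using assms by (intro word_cong.contract[of _ xs a b c ys]) (auto simp: Altword_inverse)
  then show ?thesis
    by (simp add: elt_def A.abs_eq_iff)
qed

lemma up_down: "up * down = elt [1, -1]"
  and down_up: "down * up = elt [-1, 1]"
  by (simp_all add: elt_mult alternating_single cat_def)

lemma up_down_up: "up * (down * up) = up"
proof -
  have "up * (down * up) = elt [1, -1, 1]"
    by (subst down_up, subst elt_mult) (simp_all add: alternating_def cat_def)
  also have "\<dots> = up"
    using elt_contract[of "[]" 1 "-1" 1 "[]"] by (simp add: alternating_def)
  finally show ?thesis .
qed

lemma down_up_down: "down * (up * down) = down"
proof -
  have "down * (up * down) = elt [-1, 1, -1]"
    by (subst up_down, subst elt_mult) (simp_all add: alternating_def cat_def)
  also have "\<dots> = down"
    using elt_contract[of "[]" "-1" 1 "-1" "[]"] by (simp add: alternating_def)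
  finally show ?thesis .
qed

lemma star_elt: "alternating ns \<Longrightarrow> star (elt ns) = elt (word_star ns)"
  unfolding elt_def
  by (metis Altword_inverse entries_inverse entries_star mem_Collect_eq star_A.abs_eq)

lemma star_up: "star up = down" and star_down: "star down = up"
  by (simp_all add: star_elt alternating_single word_star_def)

text \<open>Spells an element of \<open>A\<close> letter by letter, with \<open>1\<close> for \<open>u\<close> and \<open>-1\<close> for \<open>v\<close>; as \<open>A\<close> has no
  unit, the empty word has no meaningful value. Unlike blocks, letters allow a word to be cut at
  any height its path passes through.\<close>

fun letters :: "int list \<Rightarrow> A" where
  "letters [] = undefined"
| "letters [x] = elt [x]"
| "letters (x # y # w) = elt [x] * letters (y # w)"

definition letter_word :: "int list \<Rightarrow> bool" where
  "letter_word w \<longleftrightarrow> w \<noteq> [] \<and> set w \<subseteq> {1, -1}"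

lemma letters_Cons: "w \<noteq> [] \<Longrightarrow> letters (x # w) = elt [x] * letters w"
  by (cases w) simp_all

lemma letters_append:
  "v \<noteq> [] \<Longrightarrow> w \<noteq> [] \<Longrightarrow> letters (v @ w) = letters v * letters w"
proof (induction v)
  case (Cons x v)
  then show ?case
    by (cases "v = []") (simp_all add: letters_Cons mult.assoc)
qed simp

lemma elt_single_letters:
  assumes "s = 1 \<or> s = -1"
  shows "elt [int (Suc n) * s] = letters (replicate (Suc n) s)"
proof (induction n)
  case (Suc n)
  have "sgn (s + int n * s) = s"
  proof -
    have "s + int n * s = int (Suc n) * s" by (simp add: algebra_simps)
    then show ?thesis using assms by (auto simp: sgn_mult)
  qed
  then have "cat [s] [int (Suc n) * s] = [int (Suc (Suc n)) * s]"
    using assms by (auto simp: cat_def algebra_simps)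
  then have "elt [int (Suc (Suc n)) * s] = elt [s] * elt [int (Suc n) * s]"
    using assms by (subst elt_mult) (auto simp: alternating_single)
  then show ?case
    by (simp only: Suc.IH) (simp add: letters_Cons)
qed simp

text \<open>Each entry \<open>n\<close> unfolds to \<open>\<bar>n\<bar>\<close> copies of the letter \<open>sgn n\<close>.\<close>

lemma elt_letters: "alternating ns \<Longrightarrow> \<exists>w. letter_word w \<and> elt ns = letters w"
proof (induction ns)
  case (Cons n ns)
  have nz: "n \<noteq> 0" using Cons.prems by (simp add: alternating_def)
  define w where "w = replicate (nat \<bar>n\<bar>) (sgn n)"
  have sgn: "sgn n = 1 \<or> sgn n = -1" using nz by (auto simp: sgn_if)
  obtain k where k: "nat \<bar>n\<bar> = Suc k" using nz by (cases "nat \<bar>n\<bar>") auto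
  have "n = int (Suc k) * sgn n"
    using k by (metis abs_mult_sgn abs_ge_zero nat_0_le)
  then have w: "elt [n] = letters w"
    using elt_single_letters[OF sgn, of k] k by (metis w_def)
  have lw: "letter_word w"
    using sgn k by (auto simp: w_def letter_word_def)
  show ?case
  proof (cases "ns = []")
    case True
    then show ?thesis using w lw by auto
  next
    case False
    then have alt: "alternating ns" and "sgn n \<noteq> sgn (hd ns)"
      using Cons.prems by (auto simp: alternating_def successively_Cons)
    then have "elt (n # ns) = elt [n] * elt ns"
      using nz by (subst elt_mult) (auto simp: cat_def alternating_single)
    moreover obtain w' where "letter_word w'" "elt ns = letters w'"
      using Cons.IH[OF alt] by blast
    ultimately show ?thesis
      using w lw by (intro exI[of _ "w @ w'"]) (auto simp: letters_append letter_word_def)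
  qed
qed (simp add: alternating_def)

lemma ex_letters: "\<exists>w. letter_word w \<and> a = letters w"
  using ex_elt elt_letters by metis

lemma A_induct [case_names up down up_mult down_mult]:
  assumes "P up" "P down" "\<And>a. P a \<Longrightarrow> P (up * a)" "\<And>a. P a \<Longrightarrow> P (down * a)"
  shows "P a"
proof -
  have "w \<noteq> [] \<Longrightarrow> set w \<subseteq> {1, -1} \<Longrightarrow> P (letters w)" for w
  proof (induction w)
    case (Cons x w)
    then show ?case
      using assms by (cases "w = []") (auto simp: letters_Cons)
  qed simp
  then show ?thesis
    using ex_letters[of a] by (auto simp: letter_word_def)
qed


section \<open>Invariants of the congruence\<close>

lemma hd_cat_sgn: "ms \<noteq> [] \<Longrightarrow> ns \<noteq> [] \<Longrightarrow> sgn (hd (cat ms ns)) = sgn (hd ms)"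
  by (cases ms rule: rev_cases; cases ns)
    (auto simp: cat_snoc_Cons hd_append sgn_add_same)

lemma last_cat_sgn: "ms \<noteq> [] \<Longrightarrow> ns \<noteq> [] \<Longrightarrow> sgn (last (cat ms ns)) = sgn (last ns)"
  by (cases ms rule: rev_cases; cases ns) (auto simp: cat_snoc_Cons sgn_add_same)

text \<open>The two shapes of a contraction. In both, the middle letter has the sign opposite to its
  neighbours, and the entry \<open>a + b + c\<close> replacing the three has the sign of \<open>a\<close> and \<open>c\<close>.\<close>

lemma contract_signs:
  assumes "alternating (xs @ [a, b, c] @ ys)" "b = 1 \<or> b = -1"
  shows "a > 0 \<and> c > 0 \<and> b = -1 \<or> a < 0 \<and> c < 0 \<and> b = 1"
  using assms
  by (auto simp: alternating_def successively_append_iff successively_Cons sgn_if split: if_splits)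

text \<open>A contraction keeps the sign of the first and last of the three entries it replaces, and
  multiplication keeps the outer ends, so the first and last letter are well defined on \<open>A\<close>.\<close>

lemma word_cong_hd_last:
  "word_cong u v \<Longrightarrow> sgn (hd (entries u)) = sgn (hd (entries v)) \<and>
    sgn (last (entries u)) = sgn (last (entries v))"
proof (induction rule: word_cong.induct)
  case (contract u xs a b c ys v)
  have "a > 0 \<and> c > 0 \<and> b = -1 \<or> a < 0 \<and> c < 0 \<and> b = 1"
    using alternating_entries[of u] contract by (intro contract_signs) auto
  then show ?case
    by (auto simp: contract hd_append)
qed (auto simp: entries_mult hd_cat_sgn last_cat_sgn)

lift_definition first_sign :: "A \<Rightarrow> int" is "\<lambda>w. sgn (hd (entries w))"
  using word_cong_hd_last by blast

lift_definition last_sign :: "A \<Rightarrow> int" is "\<lambda>w. sgn (last (entries w))"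
  using word_cong_hd_last by blast

text \<open>The number of pairs of adjacent equal letters: a block \<open>n\<close> contains \<open>\<bar>n\<bar> - 1\<close> of them.
  Replacing \<open>uvu\<close> by \<open>u\<close> does not change it, because the removed pairs \<open>uv\<close> and \<open>vu\<close> are
  pairs of distinct letters.\<close>

definition word_doubles :: "int list \<Rightarrow> int" where
  "word_doubles ns = (\<Sum>n\<leftarrow>ns. \<bar>n\<bar> - 1)"

lemma abs_add_same: "sgn x = sgn y \<Longrightarrow> \<bar>x + y\<bar> = \<bar>x\<bar> + \<bar>y\<bar>" for x y :: int
  by (auto simp: sgn_if split: if_splits)

lemma word_doubles_cat:
  assumes "ms \<noteq> []" "ns \<noteq> []"
  shows "word_doubles (cat ms ns) =
    word_doubles ms + word_doubles ns + of_bool (sgn (last ms) = sgn (hd ns))"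
  using assms by (cases ms rule: rev_cases; cases ns)
    (auto simp: word_doubles_def cat_snoc_Cons abs_add_same)

lemma word_cong_doubles:
  "word_cong u v \<Longrightarrow> word_doubles (entries u) = word_doubles (entries v)"
proof (induction rule: word_cong.induct)
  case (contract u xs a b c ys v)
  have "a > 0 \<and> c > 0 \<and> b = -1 \<or> a < 0 \<and> c < 0 \<and> b = 1"
    using alternating_entries[of u] contract by (intro contract_signs) auto
  then show ?case
    by (auto simp: contract word_doubles_def)
next
  case (mult u u' v v')
  then show ?case
    using word_cong_hd_last[of u u'] word_cong_hd_last[of v v']
    by (simp add: entries_mult word_doubles_cat)
qed auto

lift_definition doubles :: "A \<Rightarrow> int" is "\<lambda>w. word_doubles (entries w)"
  by (rule word_cong_doubles)

text \<open>The maximum of all partial sums, the empty one included: the maximal height of the path.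
  It suffices to look at the ends of the blocks, since the path is monotone along a block.\<close>

fun word_peak :: "int list \<Rightarrow> int" where
  "word_peak [] = 0"
| "word_peak (n # ns) = max 0 (n + word_peak ns)"

lemma word_peak_nonneg: "word_peak ns \<ge> 0"
  by (cases ns) auto

lemma word_peak_append:
  "word_peak (ms @ ns) = max (word_peak ms) (sum_list ms + word_peak ns)"
  by (induction ms) (auto simp: word_peak_nonneg max_def)

lemma word_peak_merge: "sgn x = sgn y \<Longrightarrow> word_peak ((x + y) # ns) = word_peak (x # y # ns)"
  using word_peak_nonneg[of ns] by (auto simp: sgn_if max_def split: if_splits)

lemma word_peak_cat:
  assumes "ms \<noteq> []" "ns \<noteq> []"
  shows "word_peak (cat ms ns) = max (word_peak ms) (sum_list ms + word_peak ns)"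
proof -
  obtain xs x where ms: "ms = xs @ [x]"
    using assms(1) by (metis rev_exhaust)
  obtain y ys where ns: "ns = y # ys"
    using assms(2) by (metis neq_Nil_conv)
  have "word_peak (cat ms ns) = word_peak (xs @ x # y # ys)"
    using word_peak_merge[of x y ys] by (auto simp: ms ns cat_snoc_Cons word_peak_append)
  also have "\<dots> = word_peak (ms @ ns)"
    by (simp add: ms ns)
  finally show ?thesis
    by (simp only: word_peak_append)
qed

text \<open>Contracting \<open>uvu\<close> to \<open>u\<close> removes a zigzag whose heights are also visited by what remains,
  so the maximal height does not change.\<close>

lemma word_cong_peak: "word_cong u v \<Longrightarrow> word_peak (entries u) = word_peak (entries v)"
proof (induction rule: word_cong.induct)
  case (contract u xs a b c ys v)
  have "a > 0 \<and> c > 0 \<and> b = -1 \<or> a < 0 \<and> c < 0 \<and> b = 1"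
    using alternating_entries[of u] contract by (intro contract_signs) auto
  then have "word_peak ([a, b, c] @ ys) = word_peak ([a + b + c] @ ys)"
    using word_peak_nonneg[of ys] by (auto simp: max_def)
  then show ?case
    by (simp only: contract word_peak_append[of xs])
next
  case (mult u u' v v')
  then show ?case
    using word_cong_sum_list[of u u'] by (simp add: entries_mult word_peak_cat)
qed auto

lift_definition peak :: "A \<Rightarrow> int" is "\<lambda>w. word_peak (entries w)"
  by (rule word_cong_peak)

lemma elt_invariants:
  assumes "alternating ns"
  shows tau_elt: "tau (elt ns) = sum_list ns"
    and first_sign_elt: "first_sign (elt ns) = sgn (hd ns)"
    and last_sign_elt: "last_sign (elt ns) = sgn (last ns)"
    and doubles_elt: "doubles (elt ns) = word_doubles ns"
    and peak_elt: "peak (elt ns) = word_peak ns"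
  using assms
  by (simp_all add: elt_def tau.abs_eq first_sign.abs_eq last_sign.abs_eq doubles.abs_eq
      peak.abs_eq Altword_inverse)

lemma tau_mult: "tau (a * b) = tau a + tau b"
  by transfer (simp add: entries_mult sum_list_cat)

lemma first_sign_mult: "first_sign (a * b) = first_sign a"
  by transfer (simp add: entries_mult hd_cat_sgn)

lemma last_sign_mult: "last_sign (a * b) = last_sign b"
  by transfer (simp add: entries_mult last_cat_sgn)

lemma doubles_mult:
  "doubles (a * b) = doubles a + doubles b + of_bool (last_sign a = first_sign b)"
  by transfer (simp add: entries_mult word_doubles_cat)

lemma peak_mult: "peak (a * b) = max (peak a) (tau a + peak b)"
  by transfer (simp add: entries_mult word_peak_cat)

lemma peak_nonneg: "peak a \<ge> 0"
  by transfer (rule word_peak_nonneg)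

lemma tau_star: "tau (star a) = - tau a"
proof transfer
  have "sum_list (map uminus ns) = - sum_list ns" for ns :: "int list"
    by (induction ns) simp_all
  then show "sum_list (entries (star w)) = - sum_list (entries w)" for w
    by (simp add: entries_star word_star_def)
qed

lemma first_sign_star: "first_sign (star a) = - last_sign a"
  by transfer (simp add: entries_star word_star_def hd_rev last_map sgn_minus)

lemma last_sign_star: "last_sign (star a) = - first_sign a"
  using first_sign_star[of "star a"] by simp

lemma doubles_nonneg: "doubles a \<ge> 0"
proof -
  obtain ns where ns: "alternating ns" "a = elt ns"
    using ex_elt by blast
  have "\<bar>n\<bar> \<ge> 1" if "n \<in> set ns" for n
  proof -
    have "n \<noteq> 0"
      using ns(1) that by (auto simp: alternating_def)
    then show ?thesis by simp
  qed
  then show ?thesis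
    using ns(1) unfolding ns(2) by (fastforce simp: doubles_elt word_doubles_def intro!: sum_list_nonneg)
qed

lemmas letter_invariants = elt_invariants[of "[1]"] elt_invariants[of "[-1]"]

lemma peak_zero_first_sign:
  assumes "peak a = 0"
  shows "first_sign a = -1"
proof -
  obtain n ns where a: "alternating (n # ns)" "a = elt (n # ns)"
    using ex_elt[of a] by (metis alternating_def neq_Nil_conv)
  then have "n < 0"
    using assms word_peak_nonneg[of ns] by (auto simp: peak_elt alternating_def)
  then show ?thesis
    using a by (simp add: first_sign_elt)
qed

text \<open>The path ends at its maximal height 0, so its last step leads up.\<close>

lemma peak_zero_last_sign:
  assumes "peak a = 0" "tau a = 0"
  shows "last_sign a = 1"
proof -
  obtain n ns where a: "alternating (ns @ [n])" "a = elt (ns @ [n])"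
    using ex_elt[of a] by (metis alternating_def rev_exhaust)
  then have "sum_list ns \<le> 0" "n \<noteq> 0"
    using assms by (auto simp: peak_elt word_peak_append alternating_def)
  then have "n > 0"
    using assms a by (simp add: tau_elt)
  then show ?thesis
    using a by (simp add: last_sign_elt)
qed

text \<open>Since \<open>vuv = v\<close>, the idempotent \<open>vu\<close> is absorbed by everything that begins with \<open>v\<close>.\<close>

lemma down_up_mult:
  assumes "first_sign a = -1"
  shows "down * up * a = a"
  using assms
proof (induction a rule: A_induct)
  case (down_mult a)
  have "down * up * (down * a) = down * (up * down) * a"
    by (simp add: mult.assoc)
  then show ?case
    by (simp only: down_up_down)
qed (simp_all add: first_sign_elt alternating_single first_sign_mult mult.assoc down_up_down)

lemma mult_down_up:
  assumes "last_sign a = 1"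
  shows "a * (down * up) = a"
proof -
  have "star (a * (down * up)) = down * up * star a"
    by (simp add: star_mult star_up star_down)
  also have "\<dots> = star a"
    using assms by (intro down_up_mult) (simp add: first_sign_star)
  finally show ?thesis
    by (metis star_star)
qed

text \<open>Without adjacent equal letters a word alternates, and the relations \<open>uvu = u\<close> and
  \<open>vuv = v\<close> shorten it to at most two letters.\<close>

lemma doubles_zero_cases:
  assumes "doubles a = 0"
  shows "a \<in> {up, down, up * down, down * up}"
  using assms
proof (induction a rule: A_induct)
  case (up_mult a)
  have "doubles a + of_bool (first_sign a = 1) = 0"
    using up_mult.prems
    by (auto simp: doubles_mult letter_invariants alternating_single word_doubles_def)
  then have "doubles a = 0" "first_sign a \<noteq> 1"
    using doubles_nonneg[of a] by (auto split: if_splits simp: of_bool_def)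
  with up_mult.IH show ?case
    by (auto simp: first_sign_mult first_sign_elt alternating_single up_down_up)
next
  case (down_mult a)
  have "doubles a + of_bool (first_sign a = -1) = 0"
    using down_mult.prems
    by (auto simp: doubles_mult letter_invariants alternating_single word_doubles_def)
  then have "doubles a = 0" "first_sign a \<noteq> -1"
    using doubles_nonneg[of a] by (auto split: if_splits simp: of_bool_def)
  with down_mult.IH show ?case
    by (auto simp: first_sign_mult first_sign_elt alternating_single down_up_down)
qed auto

lemma doubles_zero_down_up:
  assumes "doubles a = 0" "first_sign a = -1" "last_sign a = 1"
  shows "a = down * up"
  using doubles_zero_cases[OF assms(1)] assms(2,3)
  by (auto simp: first_sign_mult last_sign_mult first_sign_elt last_sign_elt alternating_single)


section \<open>The set \<open>A\<^sub>+\<close>\<close>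

text \<open>A shortest representative is reduced, because a contraction would shorten it.\<close>

lemma ex_reduced: "\<exists>ns. reduced ns \<and> a = elt ns"
proof -
  obtain ns where ns: "alternating ns" "a = elt ns"
    and min: "\<And>ms. alternating ms \<Longrightarrow> a = elt ms \<Longrightarrow> length ns \<le> length ms"
    using ex_has_least_nat[of "\<lambda>ns. alternating ns \<and> a = elt ns" _ length] ex_elt[of a] by metis
  have "ns ! j \<noteq> 1 \<and> ns ! j \<noteq> -1" if j: "1 \<le> j" "j + 1 < length ns" for j
  proof (rule ccontr)
    assume unit: "\<not> ?thesis"
    define xs ys where "xs = take (j - 1) ns" and "ys = drop (j + 2) ns"
    have split: "ns = xs @ [ns ! (j - 1), ns ! j, ns ! (j + 1)] @ ys"
    proof -
      have "drop (j - 1) ns = ns ! (j - 1) # ns ! j # ns ! (j + 1) # ys"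
        using j Cons_nth_drop_Suc[of "j - 1" ns] Cons_nth_drop_Suc[of j ns]
          Cons_nth_drop_Suc[of "j + 1" ns] by (simp add: ys_def)
      then show ?thesis
        by (metis append_Cons append_Nil append_take_drop_id xs_def)
    qed
    let ?ms = "xs @ [ns ! (j - 1) + ns ! j + ns ! (j + 1)] @ ys"
    have alt: "alternating (xs @ [ns ! (j - 1), ns ! j, ns ! (j + 1)] @ ys)"
      using ns(1) split by simp
    have "alternating ?ms" "a = elt ?ms"
      using alternating_contract[OF alt] elt_contract[OF alt] unit ns(2) split by auto
    then have "length ns \<le> length ?ms"
      by (rule min)
    moreover have "length ns = length ?ms + 2"
      by (subst split) simp
    ultimately show False by simp
  qed
  then show ?thesis
    using ns by (auto simp: reduced_def)
qed

text \<open>The first and last letter do not depend on the representative, so membership in \<open>A\<^sub>+\<close>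
  can be read off without knowing the reduced form. An element that begins with \<open>v\<close> and ends
  with \<open>u\<close> has at least two blocks in any representative.\<close>

lemma A_plus_iff: "a \<in> A_plus \<longleftrightarrow> first_sign a = -1 \<and> last_sign a = 1"
proof
  assume "a \<in> A_plus"
  then show "first_sign a = -1 \<and> last_sign a = 1"
    by (auto simp: A_plus_def reduced_def first_sign_elt last_sign_elt)
next
  assume signs: "first_sign a = -1 \<and> last_sign a = 1"
  obtain ns where ns: "reduced ns" "a = elt ns"
    using ex_reduced by blast
  then have "alternating ns"
    by (simp add: reduced_def)
  then have ends: "hd ns < 0" "last ns > 0"
    using signs ns by (auto simp: first_sign_elt last_sign_elt sgn_if split: if_splits)
  moreover have "length ns \<ge> 2"
    using ends \<open>alternating ns\<close> by (cases ns; cases "tl ns") (auto simp: alternating_def)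
  ultimately show "a \<in> A_plus"
    using ns by (auto simp: A_plus_def)
qed


section \<open>Factorisation of elements below height zero\<close>

lemma not_Irr_factor:
  assumes "p \<in> S" "p \<notin> Irr S"
  obtains m n where "m \<in> S" "n \<in> S" "p = m * n" "p \<noteq> m" "p \<noteq> n"
  using assms by (auto simp: Irr_def)

text \<open>If \<open>a\<close> is not irreducible, it is a product \<open>m n\<close> in \<open>A\<^sup>0\<close> with \<open>m \<noteq> a \<noteq> n\<close>. The path of \<open>a\<close>
  runs through those of \<open>m\<close> and \<open>n\<close> one after the other, both starting at height 0, so both
  factors satisfy the hypotheses again. The last letter \<open>u\<close> of \<open>m\<close> differs from the first letter
  \<open>v\<close> of \<open>n\<close>, so no new adjacent pair arises and the counts of such pairs add up. Neither count
  is zero: otherwise that factor would be \<open>vu\<close> and \<open>a\<close> would equal the other one. Hence both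
  counts are smaller than that of \<open>a\<close>.\<close>

lemma peak_zero_in_D0:
  assumes "tau a = 0" "peak a = 0"
  shows "a \<in> D0"
  using assms
proof (induction "nat (doubles a)" arbitrary: a rule: less_induct)
  case less
  show ?case
  proof (cases "a \<in> Irr A0")
    case True
    then have "a \<in> Irr_plus_A0"
      using less.prems peak_zero_first_sign peak_zero_last_sign
      by (simp add: Irr_plus_A0_def A_plus_iff)
    then show ?thesis
      unfolding D0_def by (rule gen_subsemigroup.gen)
  next
    case False
    then obtain m n where mn: "tau m = 0" "tau n = 0" "a = m * n" "a \<noteq> m" "a \<noteq> n"
      using less.prems not_Irr_factor[of a A0] by (auto simp: A0_def)
    then have peaks: "peak m = 0" "peak n = 0"
      using less.prems peak_nonneg[of m] peak_nonneg[of n] by (auto simp: peak_mult)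
    note signs = peak_zero_first_sign[OF peaks(1)] peak_zero_first_sign[OF peaks(2)]
      peak_zero_last_sign[OF peaks(1) mn(1)] peak_zero_last_sign[OF peaks(2) mn(2)]
    have "doubles m \<noteq> 0"
      using doubles_zero_down_up[of m] down_up_mult[of n] signs mn by auto
    moreover have "doubles n \<noteq> 0"
      using doubles_zero_down_up[of n] mult_down_up[of m] signs mn by auto
    moreover have "doubles a = doubles m + doubles n"
      using mn signs by (simp add: doubles_mult)
    ultimately have "nat (doubles m) < nat (doubles a)" "nat (doubles n) < nat (doubles a)"
      using doubles_nonneg[of m] doubles_nonneg[of n] by auto
    then have "m \<in> D0" "n \<in> D0"
      using less.hyps mn peaks by blast+
    then show ?thesis
      unfolding mn D0_def by (rule gen_subsemigroup.mult)
  qed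
qed


section \<open>Paths of irreducible elements\<close>

lemma tau_letters: "letter_word w \<Longrightarrow> tau (letters w) = sum_list w"
proof (induction w)
  case (Cons x w)
  then show ?case
    by (cases "w = []")
      (auto simp: letter_word_def letters_Cons tau_mult tau_elt alternating_single)
qed (simp add: letter_word_def)

lemma first_sign_letters: "letter_word w \<Longrightarrow> first_sign (letters w) = hd w"
  by (cases w; cases "tl w")
    (auto simp: letter_word_def first_sign_mult first_sign_elt alternating_single)

lemma peak_letters: "letter_word w \<Longrightarrow> peak (letters w) = word_peak w"
proof (induction w)
  case (Cons x w)
  then show ?case
    using peak_nonneg[of "letters w"]
    by (cases "w = []")
      (auto simp: letter_word_def letters_Cons peak_mult tau_elt peak_elt alternating_single)
qed (simp add: letter_word_def)

lemma word_peak_le: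
  assumes "\<And>k. sum_list (take k w) \<le> c"
  shows "word_peak w \<le> c"
  using assms
proof (induction w arbitrary: c)
  case (Cons x w)
  have "sum_list (take k w) \<le> c - x" for k
    using Cons.prems[of "Suc k"] by simp
  then have "word_peak w \<le> c - x"
    by (rule Cons.IH)
  then show ?case
    using Cons.prems[of 0] by simp
qed simp

lemma letter_word_take_drop:
  assumes "letter_word w" "0 < k" "k < length w"
  shows "letter_word (take k w)" "letter_word (drop k w)"
  using assms set_take_subset[of k w] set_drop_subset[of k w] by (auto simp: letter_word_def)

text \<open>Irreducibility only says that a factor in \<open>A\<^sup>0\<close> equals \<open>p\<close> as an element of \<open>A\<close>, and
  arbitrary words for \<open>p\<close> do return to height 0 (already \<open>vu = vuvu\<close>). For a shortest word,
  cutting at such a return contradicts minimality.\<close>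

lemma Irr_plus_shortest_word:
  assumes p: "p \<in> Irr_plus_A0"
  obtains w where "letter_word w" "p = letters w" "hd w = -1" "sum_list w = 0"
    "\<And>k. 0 < k \<Longrightarrow> k < length w \<Longrightarrow> sum_list (take k w) \<noteq> 0"
proof -
  have irr: "p \<in> Irr A0" and first: "first_sign p = -1"
    using p by (auto simp: Irr_plus_A0_def A_plus_iff)
  obtain w where w: "letter_word w" "p = letters w"
    and min: "\<And>w'. letter_word w' \<Longrightarrow> p = letters w' \<Longrightarrow> length w \<le> length w'"
    using ex_has_least_nat[of "\<lambda>w. letter_word w \<and> p = letters w" _ length] ex_letters[of p]
    by metis
  have sum: "sum_list w = 0"
    using irr w tau_letters by (auto simp: Irr_def A0_def)
  have "sum_list (take k w) \<noteq> 0" if k: "0 < k" "k < length w" for k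
  proof
    assume zero: "sum_list (take k w) = 0"
    let ?m = "letters (take k w)" and ?n = "letters (drop k w)"
    have lw: "letter_word (take k w)" "letter_word (drop k w)"
      using letter_word_take_drop w(1) k by blast+
    have "sum_list (take k w) + sum_list (drop k w) = 0"
      using sum by (metis append_take_drop_id sum_list_append)
    then have "?m \<in> A0" "?n \<in> A0"
      using zero lw by (simp_all add: A0_def tau_letters)
    moreover have "p = ?m * ?n"
      using w(2) lw letters_append[of "take k w" "drop k w"] by (simp add: letter_word_def)
    ultimately have "p = ?m \<or> p = ?n"
      using irr by (auto simp: Irr_def)
    then show False
      using min lw k by fastforce
  qed
  moreover have "hd w = -1"
    using first first_sign_letters w by simp
  ultimately show ?thesis
    using that w sum by blast
qed

text \<open>The path begins with a step down and moves by unit steps, so it cannot become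
  nonnegative without visiting height 0.\<close>

lemma negative_excursion:
  assumes w: "letter_word w" "hd w = -1"
    and nz: "\<And>k. 0 < k \<Longrightarrow> k < length w \<Longrightarrow> sum_list (take k w) \<noteq> 0"
  shows "k < length w \<Longrightarrow> 0 < k \<Longrightarrow> sum_list (take k w) < 0"
proof (induction k)
  case (Suc k)
  show ?case
  proof (cases "k = 0")
    case True
    then show ?thesis using w by (cases w) (auto simp: letter_word_def)
  next
    case False
    have "w ! k \<in> {1, -1}"
      using w(1) Suc.prems nth_mem[of k w] unfolding letter_word_def by force
    then have "w ! k \<le> 1"
      by auto
    then have "sum_list (take (Suc k) w) \<le> sum_list (take k w) + 1"
      using Suc.prems by (simp add: take_Suc_conv_app_nth)
    then show ?thesis
      using Suc False nz[of "Suc k"] by force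
  qed
qed simp

text \<open>Removing the first step down and the last step up lifts the strictly negative part of the
  path by one, to a path that stays at or below height 0.\<close>

lemma Irr_plus_cases:
  assumes "p \<in> Irr_plus_A0"
  obtains "p = down * up" | q where "p = down * q * up" "tau q = 0" "peak q = 0"
proof -
  obtain w where w: "letter_word w" "p = letters w" "hd w = -1" "sum_list w = 0"
    and nz: "\<And>k. 0 < k \<Longrightarrow> k < length w \<Longrightarrow> sum_list (take k w) \<noteq> 0"
    using Irr_plus_shortest_word[OF assms] by metis
  note neg = negative_excursion[OF w(1,3) nz]
  obtain v where "w = -1 # v"
    using w by (cases w) (auto simp: letter_word_def)
  moreover from this have "v \<noteq> []"
    using w(4) by auto
  ultimately obtain w' z where wz: "w = -1 # w' @ [z]"
    by (metis rev_exhaust)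
  \<comment> \<open>Before its last step the path is below 0, and it ends at 0.\<close>
  have z: "z = 1"
    using neg[of "Suc (length w')"] w by (auto simp: wz letter_word_def)
  show ?thesis
  proof (cases "w' = []")
    case True
    then show ?thesis using that(1) w(2) wz z by simp
  next
    case False
    then have lw: "letter_word w'"
      using w(1) by (auto simp: wz letter_word_def)
    have "sum_list (take k w') \<le> 0" for k
      using neg[of "Suc (min k (length w'))"] by (cases "k \<le> length w'") (auto simp: wz)
    then have "word_peak w' = 0"
      using word_peak_le[of w' 0] word_peak_nonneg[of w'] by simp
    moreover have "p = down * letters w' * up"
      using w(2) False by (simp add: wz z letters_Cons letters_append mult.assoc)
    moreover have "sum_list w' = 0"
      using w(4) by (simp add: wz z)
    ultimately show ?thesis
      using that(2) lw by (simp add: tau_letters peak_letters)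
  qed
qed


section \<open>The splitting\<close>

lemma D0_signs: "d \<in> D0 \<Longrightarrow> first_sign d = -1 \<and> last_sign d = 1"
  unfolding D0_def
  by (induction rule: gen_subsemigroup.induct)
    (auto simp: Irr_plus_A0_def A_plus_iff first_sign_mult last_sign_mult)

lemma Irr_star:
  assumes "\<And>a. a \<in> S \<Longrightarrow> star a \<in> S" "p \<in> Irr S"
  shows "star p \<in> Irr S"
proof (rule ccontr)
  assume "star p \<notin> Irr S"
  then obtain m n where "m \<in> S" "n \<in> S" "star p = m * n" "star p \<noteq> m" "star p \<noteq> n"
    using assms not_Irr_factor[of "star p" S] by (auto simp: Irr_def)
  then have "star n \<in> S" "star m \<in> S" "p = star n * star m" "p \<noteq> star m" "p \<noteq> star n"
    using assms by (metis star_mult star_star)+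
  then show False
    using assms(2) by (auto simp: Irr_def)
qed

lemma D0_star: "d \<in> D0 \<Longrightarrow> star d \<in> D0"
  unfolding D0_def
proof (induction rule: gen_subsemigroup.induct)
  case (gen a)
  then have "star a \<in> Irr_plus_A0"
    by (auto simp: Irr_plus_A0_def A_plus_iff first_sign_star last_sign_star A0_def tau_star
        intro!: Irr_star)
  then show ?case by (rule gen_subsemigroup.gen)
qed (simp add: star_mult gen_subsemigroup.mult)

lemma D0_subset_D1: "D0 \<subseteq> D1"
proof
  fix d assume "d \<in> D0"
  then show "d \<in> D1"
    unfolding D0_def D1_def
    by (induction rule: gen_subsemigroup.induct) (auto intro: gen_star_subsemigroup.intros)
qed

lemma up_down_in_D1: "up * down \<in> D1"
  unfolding up_down D1_def by (simp add: gen_star_subsemigroup.gen)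

lemma D1_mult: "a \<in> D1 \<Longrightarrow> b \<in> D1 \<Longrightarrow> a * b \<in> D1"
  unfolding D1_def by (rule gen_star_subsemigroup.mult)

lemma omega_mult:
  assumes "b \<in> D0"
  shows "omega (a * b) = omega a * omega b"
proof -
  have "omega a * omega b = up * a * (down * up * b) * down"
    by (simp add: omega_def mult.assoc)
  also have "\<dots> = omega (a * b)"
    using assms D0_signs[of b] by (subst down_up_mult) (simp_all add: omega_def mult.assoc)
  finally show ?thesis by simp
qed

lemma omega_star: "omega (star a) = star (omega a)"
  by (simp add: omega_def star_mult star_up star_down mult.assoc)

lemma alpha_star: "alpha (star a) = star (alpha a)"
  by (simp add: alpha_def star_mult star_up star_down mult.assoc)

lemma alpha_omega:
  assumes "d \<in> D0"
  shows "alpha (omega d) = d"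
proof -
  have "alpha (omega d) = down * up * d * (down * up)"
    by (simp add: alpha_def omega_def mult.assoc)
  also have "\<dots> = d"
    using assms D0_signs by (simp add: down_up_mult mult_down_up)
  finally show ?thesis .
qed

lemma omega_Irr_plus_in_D1:
  assumes "p \<in> Irr_plus_A0"
  shows "omega p \<in> D1"
  using assms
proof (cases rule: Irr_plus_cases)
  case 1
  have "omega p = up * down * (up * down)"
    by (simp add: 1 omega_def mult.assoc)
  then show ?thesis
    using D1_mult up_down_in_D1 by simp
next
  case (2 q)
  have "omega p = up * down * q * (up * down)"
    by (simp add: 2 omega_def mult.assoc)
  moreover have "q \<in> D1"
    using peak_zero_in_D0 2 D0_subset_D1 by blast
  ultimately show ?thesis
    using D1_mult up_down_in_D1 by simp
qed

lemma omega_D0_in_D1: "d \<in> D0 \<Longrightarrow> omega d \<in> D1"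
  unfolding D0_def
proof (induction rule: gen_subsemigroup.induct)
  case (gen p)
  then show ?case by (rule omega_Irr_plus_in_D1)
next
  case (mult a b)
  then show ?case
    using omega_mult[of b a] D1_mult by (simp add: D0_def)
qed

lemma omega_up_down: "omega d = up * down * omega d * (up * down)"
proof -
  have "up * down * omega d * (up * down) = up * (down * up) * d * (down * (up * down))"
    by (simp add: omega_def mult.assoc)
  then show ?thesis
    by (simp only: up_down_up down_up_down omega_def)
qed

theorem proposition3p15:
  shows "omega ` D0 \<subseteq> {elt [1, -1] * d * elt [1, -1] | d. d \<in> D1} \<and>
         star_semigroup_hom_on D0 D1 omega \<and>
         (\<forall>n. alpha (star n) = star (alpha n)) \<and>
         (\<forall>n\<in>D0. (alpha \<circ> omega) n = n)"
proof (intro conjI)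
  show "omega ` D0 \<subseteq> {elt [1, -1] * d * elt [1, -1] | d. d \<in> D1}"
    using omega_D0_in_D1 omega_up_down unfolding up_down by blast
  have "star_subsemigroup D0"
    using D0_star by (auto simp: star_subsemigroup_def D0_def intro: gen_subsemigroup.mult)
  moreover have "star_subsemigroup D1"
    by (auto simp: star_subsemigroup_def D1_def intro: gen_star_subsemigroup.intros)
  ultimately show "star_semigroup_hom_on D0 D1 omega"
    using omega_D0_in_D1 by (auto simp: star_semigroup_hom_on_def omega_mult omega_star)
  show "\<forall>n. alpha (star n) = star (alpha n)"
    by (simp add: alpha_star)
  show "\<forall>n\<in>D0. (alpha \<circ> omega) n = n"
    by (simp add: alpha_omega)
qed

end
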